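(* Let $0<q<1$, let $\nu=(0\le\nu_1\le\nu_2\le\dots)$ be a non-decreasing sequence of non-negative integers, and let $$H^\nu(t)=\frac{\prod_{i=0}^{\infty}(1-q^it)}{\prod_{j=1}^{\infty}(1-q^{\nu_j+j-1}t)}$$ be the function corresponding to the extreme $q$-central measure $\mathcal E^\nu$ parameterized by $\nu$. Let $d^\nu[i,j]$ be the semi-infinite $q$-Toeplitz matrix constructed from $H^\nu$. Then all initial minors of $d^\nu[i,j]$ are non-negative.
   Context: A semi-infinite matrix $d[i,j]$, $i>0$, $j>0$, is a semi-infinite $q$-Toeplitz matrix if $$d[i,j+1]=d[i-1,j]+(q^{1-j}-q^{1-i})\,d[i,j]\qquad\text{for all }i>0,\ j>0,$$ with the convention $d[i,j]=0$ if $i<1$ or $j<1$. Given a function $H(t)$, its associated $q$-Toeplitz matrix is constructed as follows: expand $H(t)=\sum_{\ell=0}^\infty c_\ell\prod_{i=0}^{\ell-1}(q^{-i}-t)$ and let $d[i,j]$ be the unique semi-infinite $q$-Toeplitz matrix with $d[i,1]=c_{i-1}$ for $i=1,2,\dots$ (it is lower triangular). An initial minor of size $N$ of $d[i,j]$ is a minor corresponding to either the first $N$ columns and arbitrary $N$ rows, or the first $N$ rows and arbitrary $N$ columns. The quotient defining $H^\nu$ is understood after cancelling common factors, i.e. $H^\nu(t)=\prod_{x\in X(\nu)}(1-q^xt)$, $X(\nu)=\mathbb Z_{\ge0}\setminus\{\nu_j+j-1:j\ge1\}$, an entire function. (The measure $\mathcal E^\nu$ is a probability measure on paths in the Gelfand–Tsetlin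 graph determined by $H^\nu$; it enters the statement only through the function $H^\nu$.) *)

theory Defs
  imports
    "HOL-Analysis.Infinite_Products"
    "Jordan_Normal_Form.Determinant"
begin

text \<open>
  Semi-infinite matrices are functions \<open>d\<close> of type \<open>nat \<Rightarrow> nat \<Rightarrow> real\<close> whose indices start at 1.
  The convention that entries with an index smaller than 1 vanish is part of the definition; it
  makes \<open>d\<close> a total function without junk values, so that the matrix below is unique.
\<close>

definition q_toeplitz :: "real \<Rightarrow> (nat \<Rightarrow> nat \<Rightarrow> real) \<Rightarrow> bool" where
  "q_toeplitz q d \<longleftrightarrow>
     (\<forall>i j. i < 1 \<or> j < 1 \<longrightarrow> d i j = 0) \<and>
     (\<forall>i>0. \<forall>j>0. d i (j + 1) =
        d (i - 1) j + (q powi (1 - int j) - q powi (1 - int i)) * d i j)"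

definition q_newton_expansion :: "real \<Rightarrow> (complex \<Rightarrow> complex) \<Rightarrow> (nat \<Rightarrow> real) \<Rightarrow> bool" where
  "q_newton_expansion q H c \<longleftrightarrow>
     (\<forall>t. (\<lambda>l. of_real (c l) * (\<Prod>i<l. of_real (q powi (- int i)) - t)) sums H t)"

text \<open>
  For \<open>0 < q < 1\<close> the coefficients \<open>c\<close> are unique: at \<open>t = q\<^sup>-\<^sup>k\<close> all terms with \<open>l > k\<close> vanish, so the
  values of \<open>H\<close> at these points determine \<open>c\<close> recursively. The first column and the recurrence then
  determine \<open>d\<close>.
\<close>

definition associated_q_toeplitz :: "real \<Rightarrow> (complex \<Rightarrow> complex) \<Rightarrow> nat \<Rightarrow> nat \<Rightarrow> real" where
  "associated_q_toeplitz q H =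
     (THE d. q_toeplitz q d \<and>
        (\<exists>c. q_newton_expansion q H c \<and> (\<forall>i\<ge>1. d i 1 = c (i - 1))))"

definition X_nu :: "(nat \<Rightarrow> nat) \<Rightarrow> nat set" where
  "X_nu \<nu> = UNIV - {\<nu> j + j - 1 | j. j \<ge> 1}"

text \<open>
  The quotient of \<open>\<Prod>i\<ge>0. 1 - q\<^sup>i t\<close> by \<open>\<Prod>j\<ge>1. 1 - q^(\<nu>\<^sub>j + j - 1) t\<close> after cancellation of the
  common factors. The sequence \<open>\<nu>\<close> is indexed from 1; the value \<open>\<nu> 0\<close> is irrelevant.
\<close>

definition H_nu :: "real \<Rightarrow> (nat \<Rightarrow> nat) \<Rightarrow> complex \<Rightarrow> complex" where
  "H_nu q \<nu> t = (\<Prod>x. if x \<in> X_nu \<nu> then 1 - of_real (q ^ x) * t else 1)"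

definition matrix_minor :: "(nat \<Rightarrow> nat \<Rightarrow> real) \<Rightarrow> nat set \<Rightarrow> nat set \<Rightarrow> real" where
  "matrix_minor d I J =
     Determinant.det (Matrix.mat (card I) (card J)
       (\<lambda>(a, b). d (sorted_list_of_set I ! a) (sorted_list_of_set J ! b)))"

definition initial_minors :: "nat \<Rightarrow> (nat \<Rightarrow> nat \<Rightarrow> real) \<Rightarrow> real set" where
  "initial_minors N d =
     {matrix_minor d I {1..N} | I. I \<subseteq> {1..} \<and> finite I \<and> card I = N} \<union>
     {matrix_minor d {1..N} J | J. J \<subseteq> {1..} \<and> finite J \<and> card J = N}"

end

theory Submission
  imports Defs
begin

text \<open>
  Let \<open>N\<^sub>l(t) = (1 - t) (q\<^sup>-\<^sup>1 - t) \<dots> (q\<^sup>1\<^sup>-\<^sup>l - t)\<close> be the Newton basis and count indices from 0. The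
  \<open>q\<close>-Toeplitz recurrence says that column \<open>j + 1\<close>, read as coefficients in this basis, is column
  \<open>j\<close> multiplied by \<open>q\<^sup>-\<^sup>j - t\<close>; so column \<open>j\<close> is the expansion of \<open>N\<^sub>j H\<close>, and the matrix
  represents multiplication by \<open>H\<close>. For \<open>H(t) = \<Prod>x\<in>X. 1 - q\<^sup>x t\<close> it is therefore a product of
  bidiagonal matrices, since \<open>(1 - q\<^sup>x t) N\<^sub>l = (1 - q\<^sup>x\<^sup>-\<^sup>l) N\<^sub>l + q\<^sup>x N\<^sub>l\<^sub>+\<^sub>1\<close>.

  \<^emph>\<open>Positivity.\<close> Read \<open>1 - q\<^sup>x\<^sup>-\<^sup>l\<close> and \<open>q\<^sup>x\<close> as the weights for a particle at \<open>l\<close> to stay or to jump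
  to \<open>l + 1\<close> when the factor of \<open>x\<close> is applied. A minor with the first \<open>N\<close> columns is then the
  total weight of the ways in which \<open>N\<close> particles can move from the sites \<open>0, \<dots>, N - 1\<close> to the sites
  given by the rows without ever colliding. The staying weight is negative for \<open>l > x\<close>, but this never matters if the factors are applied in increasing
  order of \<open>x\<close>: at time \<open>x\<close> the occupied sites \<open>\<ge> x\<close>, if any, form a block that begins at \<open>x\<close>, the particle
  at \<open>x\<close> has staying weight \<open>0\<close> and must jump, and it pushes the whole block. Lemma
  \<open>row_minor_mult_mat\<close> is this induction; the exclusion of collisions is the vanishing of
  determinants with two equal rows.

  \<^emph>\<open>Convergence.\<close> Multiplied by \<open>N\<^sub>l(0)\<close>, the coefficients of the partial products are the law of a
  single such particle started at \<open>0\<close>, which stays or jumps with probability \<open>1 - q\<^sup>x\<^sup>-\<^sup>l\<close> or \<open>q\<^sup>x\<^sup>-\<^sup>l\<close>.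
  Once some time \<open>y \<notin> X\<close> has passed, the lag \<open>x - l\<close> is at least 1, and the expected
  jump probability decays geometrically (\<open>total_flow_contracts\<close>). Hence the laws converge in
  \<open>\<ell>\<^sup>1\<close>. As \<open>N\<^sub>l(t) / N\<^sub>l(0)\<close> is bounded uniformly in \<open>l\<close>, the limit gives a Newton series that
  converges to \<open>H\<close> everywhere (\<open>newton_series_sums\<close>). Here \<open>y = \<nu>\<^sub>1\<close> will do. Some \<open>y\<close> must
  exist: the full product \<open>\<Prod>i. 1 - q\<^sup>i t\<close> vanishes at all nodes and has no Newton expansion.

  By \<open>associated_q_toeplitz_H_nu\<close> the matrix is the entrywise limit of the finite products, so its
  minors with the first \<open>N\<close> columns are limits of non-negative numbers. It is lower triangular, so a
  minor with the first \<open>N\<close> rows vanishes unless its columns are also the first \<open>N\<close>.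
\<close>

section \<open>Multilinear expansion of determinants\<close>

text \<open>
  The expansion by which a product with a bidiagonal matrix, whose rows are combinations of two old
  rows, acts on minors; it takes the place of the Cauchy--Binet formula.
\<close>

lemma det_row_sums:
  fixes A B :: "nat \<Rightarrow> nat \<Rightarrow> 'a::comm_ring_1"
  shows "Determinant.det (Matrix.mat N N (\<lambda>(a, b). u a * A a b + v a * B a b)) =
    (\<Sum>S\<in>Pow {..<N}. prod u S * prod v ({..<N} - S) *
       Determinant.det (Matrix.mat N N (\<lambda>(a, b). if a \<in> S then A a b else B a b)))"
proof -
  let ?P = "{p. p permutes {0..<N}}"
  let ?t = "\<lambda>S p a. if a \<in> S then A a (p a) else B a (p a)"
  have row: "(\<Prod>a<N. u a * A a (p a) + v a * B a (p a)) =
      (\<Sum>S\<in>Pow {..<N}. prod u S * prod v ({..<N} - S) * (\<Prod>a<N. ?t S p a))" for p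
  proof -
    have "prod u S * prod v ({..<N} - S) * (\<Prod>a<N. ?t S p a) =
        (\<Prod>a\<in>S. u a * A a (p a)) * (\<Prod>a\<in>{..<N} - S. v a * B a (p a))"
      if "S \<in> Pow {..<N}" for S
    proof -
      have "(\<Prod>a<N. ?t S p a) = (\<Prod>a\<in>{..<N} - S. ?t S p a) * (\<Prod>a\<in>S. ?t S p a)"
        using that by (intro prod.subset_diff) auto
      then show ?thesis by (simp add: prod.distrib mult_ac)
    qed
    then show ?thesis by (simp add: prod_add)
  qed
  have lt: "p a < N" if "p permutes {0..<N}" "a < N" for p a
    using permutes_in_image[OF that(1), of a] that(2) by simp
  have mix: "Determinant.det (Matrix.mat N N (\<lambda>(a, b). if a \<in> S then A a b else B a b)) =
      (\<Sum>p\<in>?P. signof p * (\<Prod>a<N. ?t S p a))" for S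
    by (auto simp: det_def'[of _ N] atLeast0LessThan lt intro!: sum.cong prod.cong)
  have "Determinant.det (Matrix.mat N N (\<lambda>(a, b). u a * A a b + v a * B a b)) =
      (\<Sum>p\<in>?P. signof p * (\<Prod>a<N. u a * A a (p a) + v a * B a (p a)))"
    by (auto simp: det_def'[of _ N] atLeast0LessThan lt intro!: sum.cong prod.cong)
  also have "\<dots> = (\<Sum>S\<in>Pow {..<N}. \<Sum>p\<in>?P. signof p * (prod u S * prod v ({..<N} - S) * (\<Prod>a<N. ?t S p a)))"
    unfolding row sum_distrib_left by (rule sum.swap)
  also have "\<dots> = (\<Sum>S\<in>Pow {..<N}. prod u S * prod v ({..<N} - S) *
       Determinant.det (Matrix.mat N N (\<lambda>(a, b). if a \<in> S then A a b else B a b)))"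
    unfolding mix sum_distrib_left by (intro sum.cong refl) (simp add: mult_ac)
  finally show ?thesis .
qed

lemma strict_mono_on_gap:
  fixes f :: "nat \<Rightarrow> nat"
  assumes f: "strict_mono_on {..<N} f" and "a \<le> b" "b < N"
  shows "f a + (b - a) \<le> f b"
  using assms(2,3)
proof (induction b rule: dec_induct)
  case (step b)
  then have "f b < f (Suc b)" by (intro strict_mono_onD[OF f]) auto
  with step show ?case by auto
qed simp

text \<open>
  Squeezed between \<open>a \<le> f 0 + a\<close> and \<open>f (N - 1) \<le> N - 1\<close>, a strictly increasing \<open>f\<close> leaves no gaps.
\<close>

lemma strict_mono_on_lessThan_id:
  fixes f :: "nat \<Rightarrow> nat"
  assumes f: "strict_mono_on {..<N} f" and "f ` {..<N} \<subseteq> {..<N}" and a: "a < N"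
  shows "f a = a"
proof -
  have "N - 1 \<in> {..<N}" using a by simp
  then have "f (N - 1) < N" using assms(2) by blast
  with strict_mono_on_gap[OF f, of a "N - 1"] strict_mono_on_gap[OF f, of 0 a] a
  show ?thesis by linarith
qed

section \<open>Minors of finite products of bidiagonal matrices\<close>

text \<open>
  The matrix, in the Newton basis, of multiplication by the product of \<open>1 - q\<^sup>x t\<close> over \<open>x < M\<close>
  in \<open>X\<close>, built one bidiagonal factor at a time.
\<close>

primrec mult_mat :: "real \<Rightarrow> nat set \<Rightarrow> nat \<Rightarrow> nat \<Rightarrow> nat \<Rightarrow> real" where
  "mult_mat q X 0 i j = (if i = j then 1 else 0)"
| "mult_mat q X (Suc M) i j =
    (if M \<in> X
     then (1 - q ^ M / q ^ i) * mult_mat q X M i j +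
          (if i = 0 then 0 else q ^ M * mult_mat q X M (i - 1) j)
     else mult_mat q X M i j)"

text \<open>
  The columns are the first \<open>N\<close>; the rows are given by a function rather than a set because the
  expansion of a bidiagonal step also produces repeated rows.
\<close>

definition row_minor :: "(nat \<Rightarrow> nat \<Rightarrow> real) \<Rightarrow> nat \<Rightarrow> (nat \<Rightarrow> nat) \<Rightarrow> real" where
  "row_minor A N f = Determinant.det (Matrix.mat N N (\<lambda>(a, b). A (f a) b))"

text \<open>
  The sites of \<open>I\<close> from \<open>x\<close> on form a block that begins at \<open>x\<close>, or there are none. This is the
  invariant that keeps the negative weights out of the minors.
\<close>

definition packed_from :: "nat \<Rightarrow> nat set \<Rightarrow> bool" where
  "packed_from x I \<longleftrightarrow> (\<forall>l\<in>I. {x..l} \<subseteq> I)"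

lemma row_minor_eq_0:
  assumes "a < N" "b < N" "a \<noteq> b" "f a = f b"
  shows "row_minor A N f = 0"
  unfolding row_minor_def
  by (rule det_identical_rows[of _ N a b]) (use assms in \<open>auto simp: row_def\<close>)

text \<open>
  The initial configuration: before any step only the sites \<open>0, \<dots>, N - 1\<close> are occupied.
\<close>

lemma row_minor_identity:
  assumes f: "strict_mono_on {..<N} f"
  shows "row_minor (mult_mat q X 0) N f = (if f ` {..<N} \<subseteq> {..<N} then 1 else 0)"
proof (cases "f ` {..<N} \<subseteq> {..<N}")
  case True
  then have "f a = a" if "a < N" for a using strict_mono_on_lessThan_id[OF f] that by blast
  then have "Matrix.mat N N (\<lambda>(a, b). mult_mat q X 0 (f a) b) = 1\<^sub>m N"
    by (intro eq_matI) auto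
  with True show ?thesis by (simp add: row_minor_def)
next
  case False
  then obtain a where a: "a < N" "f a \<ge> N" by force
  have "(\<Prod>i<N. Matrix.mat N N (\<lambda>(a, b). mult_mat q X 0 (f a) b) $$ (i, p i)) = 0"
    if "p permutes {..<N}" for p
  proof -
    have "p a < N" using permutes_in_image[OF that, of a] a by simp
    then show ?thesis using a by (intro prod_zero) (auto intro!: bexI[of _ a])
  qed
  then have "row_minor (mult_mat q X 0) N f = 0"
    unfolding row_minor_def by (subst det_def'[of _ N])
      (auto simp del: mult_mat.simps simp: atLeast0LessThan intro!: sum.neutral)
  with False show ?thesis by simp
qed

text \<open>
  Induction on the time \<open>x\<close>. Multilinearity splits every row \<open>f a\<close> of the new matrix into the old row
  \<open>f a\<close> (the particle stayed) and the old row \<open>f a - 1\<close> (it jumped), so the minor is a sum over the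
  sets \<open>S\<close> of particles that stayed. In a non-zero summand the old configuration \<open>g S\<close> has
  no repetition and satisfies the invariant. Only particles below \<open>x\<close> can then have stayed, so that all
  staying weights are positive and the new configuration satisfies the invariant at \<open>x + 1\<close>.
\<close>

lemma row_minor_mult_mat:
  assumes q: "0 < q" "q < 1" and "strict_mono_on {..<N} f"
  shows "0 \<le> row_minor (mult_mat q X x) N f \<and>
    (row_minor (mult_mat q X x) N f \<noteq> 0 \<longrightarrow> packed_from x (f ` {..<N}))"
  using assms(3)
proof (induction x arbitrary: f)
  case 0
  have "packed_from 0 (f ` {..<N})" if "f ` {..<N} \<subseteq> {..<N}"
    using strict_mono_on_lessThan_id[OF 0 that] by (force simp: packed_from_def)
  then show ?case unfolding row_minor_identity[OF 0] by simp
next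
  case (Suc x)
  show ?case
  proof (cases "x \<in> X")
    case False
    then have "row_minor (mult_mat q X (Suc x)) N f = row_minor (mult_mat q X x) N f"
      by (simp add: row_minor_def)
    moreover have "packed_from (Suc x) (f ` {..<N})" if "packed_from x (f ` {..<N})"
      using that by (fastforce simp: packed_from_def)
    ultimately show ?thesis using Suc.IH[OF Suc.prems] by metis
  next
    case True
    define u where "u a = 1 - q ^ x / q ^ f a" for a
    define v where "v a = (if f a = 0 then 0 else q ^ x)" for a
    define g where "g S a = (if a \<in> S then f a else f a - 1)" for S a
    define w where "w S = prod u S * prod v ({..<N} - S) * row_minor (mult_mat q X x) N (g S)" for S
    have expand: "row_minor (mult_mat q X (Suc x)) N f = (\<Sum>S\<in>Pow {..<N}. w S)"
    proof -
      have "row_minor (mult_mat q X (Suc x)) N f = Determinant.det (Matrix.mat N N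
          (\<lambda>(a, b). u a * mult_mat q X x (f a) b + v a * mult_mat q X x (f a - 1) b))"
        unfolding row_minor_def using True
        by (intro arg_cong[where f = Determinant.det] eq_matI) (auto simp: u_def v_def)
      moreover have "(if a \<in> S then mult_mat q X x (f a) b else mult_mat q X x (f a - 1) b) =
          mult_mat q X x (g S a) b" for S a b
        by (simp add: g_def)
      ultimately show ?thesis
        by (simp only: det_row_sums w_def row_minor_def)
    qed
    have summand: "0 \<le> w S \<and> packed_from (Suc x) (f ` {..<N})"
      if S: "S \<subseteq> {..<N}" and nz: "w S \<noteq> 0" for S
    proof -
      have finS: "finite S" using S finite_subset by blast
      have u_nz: "f a \<noteq> x" if "a \<in> S" for a
      proof
        assume "f a = x"
        then have "u a = 0" using q by (simp add: u_def)
        then have "prod u S = 0" using finS that by auto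
        then show False using nz by (simp add: w_def)
      qed
      have v_nz: "f a \<noteq> 0" if "a < N" "a \<notin> S" for a
      proof
        assume "f a = 0"
        then have "v a = 0" by (simp add: v_def)
        then have "prod v ({..<N} - S) = 0" using that by auto
        then show False using nz by (simp add: w_def)
      qed
      have minor_nz: "row_minor (mult_mat q X x) N (g S) \<noteq> 0" using nz by (auto simp: w_def)
      have mono: "strict_mono_on {..<N} (g S)"
      proof (rule strict_mono_onI)
        fix a b assume ab: "a \<in> {..<N}" "b \<in> {..<N}" "a < b"
        then have "f a < f b" by (intro strict_mono_onD[OF Suc.prems])
        then have "g S a \<le> g S b" by (auto simp: g_def)
        moreover have "g S a \<noteq> g S b" using row_minor_eq_0[of a N b "g S"] minor_nz ab by auto
        ultimately show "g S a < g S b" by simp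
      qed
      from Suc.IH[OF mono] minor_nz
      have pos: "0 \<le> row_minor (mult_mat q X x) N (g S)" and packed: "packed_from x (g S ` {..<N})"
        by auto
      have inj_f: "inj_on f {..<N}" using Suc.prems by (rule strict_mono_on_imp_inj_on)
      \<comment> \<open>If a particle at or above \<open>x\<close> stays, then so does its left neighbour, as it would land on an
      occupied site. Descending through the block, the particle at \<open>x\<close> stays, which has weight 0.\<close>
      have S_less: "f a < x" if a: "a \<in> S" for a
      proof (rule ccontr)
        assume "\<not> f a < x"
        then have "x \<le> f a" by simp
        then have "\<exists>b\<in>S. f b = x"
        proof (induction rule: inc_induct)
          case base
          then show ?case using a by blast
        next
          case (step l)
          then obtain b where b: "b \<in> S" "f b = Suc l" by blast
          have "f a \<in> g S ` {..<N}" using a S by (force simp: g_def)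
          then have "{x..f a} \<subseteq> g S ` {..<N}" using packed unfolding packed_from_def by blast
          moreover have "l \<in> {x..f a}" using step.hyps by simp
          ultimately have "l \<in> g S ` {..<N}" by (rule subsetD)
          then obtain c where c: "c < N" "g S c = l" by (metis imageE lessThan_iff)
          have "c \<in> S"
          proof (rule ccontr)
            assume "c \<notin> S"
            then have "f c = f b" using c v_nz[of c] b by (simp add: g_def)
            then have "c = b" using inj_onD[OF inj_f, of c b] c b S by auto
            then show False using \<open>c \<notin> S\<close> b by simp
          qed
          then show ?case using c by (auto simp: g_def)
        qed
        then show False using u_nz by blast
      qed
      have "0 \<le> u a" if "a \<in> S" for a
        using power_decreasing[of "f a" x q] S_less[OF that] q by (simp add: u_def)
      moreover have "0 \<le> v a" for a using q by (simp add: v_def)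
      ultimately have "0 \<le> w S" unfolding w_def by (intro mult_nonneg_nonneg prod_nonneg pos) auto
      moreover have "packed_from (Suc x) (f ` {..<N})"
        unfolding packed_from_def
      proof (intro ballI subsetI)
        fix l m assume l: "l \<in> f ` {..<N}" and m: "m \<in> {Suc x..l}"
        then obtain a where a: "a < N" "f a = l" by blast
        have "a \<notin> S" using S_less[of a] a m by auto
        then have "l - 1 \<in> g S ` {..<N}" using a by (force simp: g_def)
        then have "{x..l - 1} \<subseteq> g S ` {..<N}" using packed unfolding packed_from_def by blast
        moreover have "m - 1 \<in> {x..l - 1}" using m by auto
        ultimately have "m - 1 \<in> g S ` {..<N}" by (rule subsetD)
        then obtain b where b: "b < N" "g S b = m - 1" by (metis imageE lessThan_iff)
        have "b \<notin> S" using S_less[of b] b m by (auto simp: g_def)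
        then have "f b = m" using b v_nz[of b] m by (auto simp: g_def)
        then show "m \<in> f ` {..<N}" using b by blast
      qed
      ultimately show ?thesis by blast
    qed
    have "0 \<le> w S" if "S \<in> Pow {..<N}" for S using summand[of S] that by (cases "w S = 0") simp_all
    then have "0 \<le> (\<Sum>S\<in>Pow {..<N}. w S)" by (rule sum_nonneg)
    moreover have "packed_from (Suc x) (f ` {..<N})" if "(\<Sum>S\<in>Pow {..<N}. w S) \<noteq> 0"
    proof -
      obtain S where "S \<in> Pow {..<N}" "w S \<noteq> 0" using \<open>sum w (Pow {..<N}) \<noteq> 0\<close> by (rule sum.not_neutral_contains_not_neutral)
      then show ?thesis using summand[of S] by simp
    qed
    ultimately show ?thesis unfolding expand by blast
  qed
qed

section \<open>The finite products as \<open>q\<close>-Toeplitz matrices\<close>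

lemma mult_mat_lower_triangular: "i < j \<Longrightarrow> mult_mat q X M i j = 0"
  by (induction M arbitrary: i) auto

lemma mult_mat_banded: "i > j + M \<Longrightarrow> mult_mat q X M i j = 0"
  by (induction M arbitrary: i) auto

text \<open>
  No step is made at time \<open>y\<close>, so at most \<open>M - 1\<close> steps are made before time \<open>M\<close>.
\<close>

lemma mult_mat_banded_gap:
  assumes "y \<notin> X" "y < M" "l \<ge> M"
  shows "mult_mat q X M l 0 = 0"
  using assms(2,3)
proof (induction M arbitrary: l)
  case (Suc M)
  show ?case
  proof (cases "M = y")
    case True
    then show ?thesis using assms(1) Suc.prems by (simp add: mult_mat_banded)
  next
    case False
    then show ?thesis using Suc by simp
  qed
qed simp

text \<open>
  Multiplication by \<open>q\<^sup>-\<^sup>j - t\<close> commutes with multiplication by \<open>1 - q\<^sup>M t\<close>; in coordinates, the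
  recurrence is preserved by every bidiagonal step.
\<close>

lemma mult_mat_recurrence:
  assumes "q \<noteq> 0"
  shows "mult_mat q X M i (Suc j) =
    (if i = 0 then 0 else mult_mat q X M (i - 1) j) + (1 / q ^ j - 1 / q ^ i) * mult_mat q X M i j"
proof (induction M arbitrary: i)
  case 0
  show ?case by auto
next
  case (Suc M)
  show ?case
  proof (cases "M \<in> X")
    case False
    then show ?thesis using Suc by simp
  next
    case True
    show ?thesis
    proof (cases i)
      case 0
      then show ?thesis using True by (simp add: Suc mult_mat_lower_triangular)
    next
      case (Suc k)
      show ?thesis
        using True assms
        by (simp add: Suc.IH Suc) (simp add: field_simps)
    qed
  qed
qed

text \<open>
  Entries of the first column at \<open>l > M\<close>, where \<open>1 - q\<^sup>M\<^sup>-\<^sup>l\<close> is negative, are zero.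
\<close>

lemma mult_mat_nonneg:
  assumes q: "0 < q" "q < 1"
  shows "0 \<le> mult_mat q X M l 0"
proof (induction M arbitrary: l)
  case (Suc M)
  show ?case
  proof (cases "l \<le> M")
    case True
    then have "q ^ M / q ^ l \<le> 1" using power_decreasing[of l M q] q by simp
    then show ?thesis using Suc q by simp
  next
    case False
    then show ?thesis using Suc q by (simp add: mult_mat_banded)
  qed
qed simp

text \<open>
  The adjoint form of one step: it moves the step from the first column to the test function \<open>\<phi>\<close>.
  With \<open>\<phi> = N\<^sub>l(t)\<close> it yields the Newton expansion, with \<open>\<phi> = q\<^sup>M\<^sup>+\<^sup>1\<^sup>-\<^sup>l N\<^sub>l(0)\<close> the decay of the total flow.
\<close>

lemma mult_mat_column_step:
  fixes \<phi> :: "nat \<Rightarrow> 'a::real_normed_field"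
  assumes "M \<in> X"
  shows "(\<Sum>l\<le>Suc M. of_real (mult_mat q X (Suc M) l 0) * \<phi> l) =
    (\<Sum>l\<le>M. of_real (mult_mat q X M l 0) *
      (of_real (1 - q ^ M / q ^ l) * \<phi> l + of_real (q ^ M) * \<phi> (Suc l)))"
proof -
  have "(\<Sum>l\<le>Suc M. of_real (mult_mat q X (Suc M) l 0) * \<phi> l) =
      (\<Sum>l\<le>Suc M. of_real ((1 - q ^ M / q ^ l) * mult_mat q X M l 0) * \<phi> l) +
      (\<Sum>l\<le>Suc M. of_real (if l = 0 then 0 else q ^ M * mult_mat q X M (l - 1) 0) * \<phi> l)"
    using assms by (simp only: mult_mat.simps if_True of_real_add distrib_right sum.distrib)
  also have "(\<Sum>l\<le>Suc M. of_real ((1 - q ^ M / q ^ l) * mult_mat q X M l 0) * \<phi> l) =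
      (\<Sum>l\<le>M. of_real ((1 - q ^ M / q ^ l) * mult_mat q X M l 0) * \<phi> l)"
    by (simp add: mult_mat_banded)
  also have "(\<Sum>l\<le>Suc M. of_real (if l = 0 then 0 else q ^ M * mult_mat q X M (l - 1) 0) * \<phi> l) =
      (\<Sum>l\<le>M. of_real (q ^ M * mult_mat q X M l 0) * \<phi> (Suc l))"
    by (subst sum.atMost_Suc_shift) simp
  finally show ?thesis
    by (simp add: sum.distrib[symmetric] algebra_simps)
qed

definition newton_basis :: "real \<Rightarrow> nat \<Rightarrow> complex \<Rightarrow> complex" where
  "newton_basis q l t = (\<Prod>i<l. of_real (1 / q ^ i) - t)"

lemma newton_expansion_partial_product:
  assumes "q \<noteq> 0"
  shows "(\<Prod>x<M. if x \<in> X then 1 - of_real (q ^ x) * t else 1) =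
    (\<Sum>l\<le>M. of_real (mult_mat q X M l 0) * newton_basis q l t)"
proof (induction M)
  case 0
  show ?case by (simp add: newton_basis_def)
next
  case (Suc M)
  show ?case
  proof (cases "M \<in> X")
    case False
    then show ?thesis using Suc by (simp add: mult_mat_banded)
  next
    case True
    have "of_real (1 - q ^ M / q ^ l) * newton_basis q l t + of_real (q ^ M) * newton_basis q (Suc l) t
       = newton_basis q l t * (1 - of_real (q ^ M) * t)" for l
      by (simp add: newton_basis_def algebra_simps)
    then have "(\<Sum>l\<le>Suc M. of_real (mult_mat q X (Suc M) l 0) * newton_basis q l t) =
        (\<Sum>l\<le>M. of_real (mult_mat q X M l 0) * newton_basis q l t) * (1 - of_real (q ^ M) * t)"
      unfolding mult_mat_column_step[OF True] by (simp only: sum_distrib_right mult.assoc)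
    then show ?thesis
      using Suc True by simp
  qed
qed

section \<open>Convergence of the Newton series\<close>

text \<open>
  This is \<open>N\<^sub>l(0)\<close>, which turns coefficients into probabilities because the partial products are 1 at
  \<open>t = 0\<close>.
\<close>

definition newton_weight :: "real \<Rightarrow> nat \<Rightarrow> real" where
  "newton_weight q l = (\<Prod>i<l. 1 / q ^ i)"

text \<open>
  The probability that the single particle started at 0 is at \<open>l\<close> before the step of time \<open>M\<close>.
\<close>

definition mass :: "real \<Rightarrow> nat set \<Rightarrow> nat \<Rightarrow> nat \<Rightarrow> real" where
  "mass q X M l = mult_mat q X M l 0 * newton_weight q l"

text \<open>
  The probability of a jump from \<open>l\<close> to \<open>l + 1\<close> at time \<open>M\<close>, provided that \<open>M \<in> X\<close>.
\<close>

definition flow :: "real \<Rightarrow> nat set \<Rightarrow> nat \<Rightarrow> nat \<Rightarrow> real" where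
  "flow q X M l = q ^ M / q ^ l * mass q X M l"

definition total_flow :: "real \<Rightarrow> nat set \<Rightarrow> nat \<Rightarrow> real" where
  "total_flow q X M = (\<Sum>l\<le>M. flow q X M l)"

text \<open>
  Factoring out \<open>N\<^sub>l(0)\<close> leaves \<open>\<Prod>i<l. 1 - q\<^sup>i t\<close>, whose modulus is at most \<open>exp (\<Sum>i. q\<^sup>i \<bar>t\<bar>)\<close>.
\<close>

lemma norm_newton_basis_le:
  assumes q: "0 < q" "q < 1"
  shows "norm (newton_basis q l t) \<le> newton_weight q l * exp (norm t / (1 - q))"
proof -
  have "norm (newton_basis q l t) = (\<Prod>i<l. 1 / q ^ i * norm (1 - of_real (q ^ i) * t))"
    unfolding newton_basis_def prod_norm[symmetric]
  proof (intro prod.cong refl)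
    fix i
    have "of_real (1 / q ^ i) - t = of_real (1 / q ^ i) * (1 - of_real (q ^ i) * t)"
      using q by (simp add: field_simps)
    then show "norm (of_real (1 / q ^ i) - t) = 1 / q ^ i * norm (1 - of_real (q ^ i) * t)"
      using q by (simp add: norm_mult norm_divide norm_power)
  qed
  also have "\<dots> = newton_weight q l * (\<Prod>i<l. norm (1 - of_real (q ^ i) * t))"
    by (simp only: newton_weight_def prod.distrib)
  also have "(\<Prod>i<l. norm (1 - of_real (q ^ i) * t)) \<le> (\<Prod>i<l. exp (q ^ i * norm t))"
  proof (intro prod_mono conjI norm_ge_zero)
    fix i
    have "norm (1 - of_real (q ^ i) * t) \<le> 1 + q ^ i * norm t"
      using norm_triangle_ineq4[of 1 "of_real (q ^ i) * t"] q by (simp add: norm_mult norm_power)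
    also have "\<dots> \<le> exp (q ^ i * norm t)" by (rule exp_ge_add_one_self)
    finally show "norm (1 - of_real (q ^ i) * t) \<le> exp (q ^ i * norm t)" .
  qed
  also have "\<dots> = exp ((\<Sum>i<l. q ^ i) * norm t)"
    by (simp add: exp_sum sum_distrib_right)
  also have "\<dots> \<le> exp (norm t / (1 - q))"
  proof -
    have "(\<Sum>i<l. q ^ i) \<le> (\<Sum>i. q ^ i)"
      using q by (intro sum_le_suminf summable_geometric) auto
    also have "\<dots> = 1 / (1 - q)" using q by (intro suminf_geometric) auto
    finally have "(\<Sum>i<l. q ^ i) * norm t \<le> 1 / (1 - q) * norm t"
      by (rule mult_right_mono) simp
    then show ?thesis by simp
  qed
  finally show ?thesis
    using q by (simp add: newton_weight_def mult_left_mono prod_nonneg)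
qed

lemma newton_weight_pos: "0 < q \<Longrightarrow> 0 < newton_weight q l"
  by (auto simp: newton_weight_def intro!: prod_pos)

context
  fixes q :: real and X :: "nat set"
  assumes q: "0 < q" "q < 1"
begin

lemma mass_nonneg: "0 \<le> mass q X M l"
  unfolding mass_def
  by (rule mult_nonneg_nonneg[OF mult_mat_nonneg[OF q] less_imp_le[OF newton_weight_pos[OF q(1)]]])

lemma flow_nonneg: "0 \<le> flow q X M l"
  using q by (simp add: flow_def mass_nonneg)

lemma flow_eq_0: "M < l \<Longrightarrow> flow q X M l = 0"
  by (simp add: flow_def mass_def mult_mat_banded)

lemma sum_flow_le: "(\<Sum>l<L. flow q X M l) \<le> total_flow q X M"
proof -
  have "(\<Sum>l<L. flow q X M l) = (\<Sum>l\<in>{..<L} \<inter> {..M}. flow q X M l)"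
    by (intro sum.mono_neutral_right) (auto simp: not_le[symmetric] intro: ccontr flow_eq_0)
  also have "\<dots> \<le> total_flow q X M"
    unfolding total_flow_def by (intro sum_mono2) (auto simp: flow_nonneg)
  finally show ?thesis .
qed

lemma mass_Suc:
  "mass q X (Suc M) l - mass q X M l =
    (if M \<in> X then (if l = 0 then 0 else flow q X M (l - 1)) - flow q X M l else 0)"
  using q by (cases l) (simp_all add: mass_def flow_def newton_weight_def field_simps)

text \<open>
  In one step, mass leaves \<open>l\<close> and enters \<open>l + 1\<close>, so each jump is counted at most twice.
\<close>

lemma sum_abs_mass_diff_le:
  "(\<Sum>l<L. \<bar>mass q X (M + k) l - mass q X M l\<bar>) \<le> (\<Sum>m<k. 2 * total_flow q X (M + m))"
proof (induction k)
  case (Suc k)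
  let ?m = "M + k"
  have "(\<Sum>l<L. if l = 0 then 0 else flow q X ?m (l - 1)) \<le> total_flow q X ?m"
  proof (cases L)
    case (Suc n)
    then show ?thesis using sum_flow_le[where L = n and M = ?m] by (simp only: Suc sum.lessThan_Suc_shift) simp
  qed (simp add: total_flow_def flow_nonneg sum_nonneg)
  moreover have "(\<Sum>l<L. \<bar>mass q X (Suc ?m) l - mass q X ?m l\<bar>) \<le>
      (\<Sum>l<L. (if l = 0 then 0 else flow q X ?m (l - 1)) + flow q X ?m l)"
    by (intro sum_mono) (auto simp: mass_Suc flow_nonneg abs_le_iff add_nonneg_nonneg intro: order_trans[OF _ flow_nonneg])
  ultimately have step: "(\<Sum>l<L. \<bar>mass q X (Suc ?m) l - mass q X ?m l\<bar>) \<le> 2 * total_flow q X ?m"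
    using sum_flow_le[where L = L and M = ?m] by (simp add: sum.distrib)
  have "(\<Sum>l<L. \<bar>mass q X (M + Suc k) l - mass q X M l\<bar>) \<le>
      (\<Sum>l<L. \<bar>mass q X (Suc ?m) l - mass q X ?m l\<bar> + \<bar>mass q X ?m l - mass q X M l\<bar>)"
    by (intro sum_mono) simp
  with step Suc show ?case by (simp add: sum.distrib)
qed simp

text \<open>
  A particle with lag \<open>g = M - l \<ge> 1\<close> contributes \<open>q\<^sup>g\<close> to the flow. If \<open>M \<in> X\<close>, it keeps this lag with
  probability \<open>q\<^sup>g \<le> q\<close> and otherwise increases it by one, which multiplies its contribution by \<open>q\<close>: on
  average the factor is \<open>q\<^sup>g + (1 - q\<^sup>g) q \<le> q + (1 - q) q\<close>. If \<open>M \<notin> X\<close>, the lag always increases.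
\<close>

lemma total_flow_contracts:
  assumes y: "y \<notin> X" "y < M"
  shows "total_flow q X (Suc M) \<le> (q + (1 - q) * q) * total_flow q X M"
proof (cases "M \<in> X")
  case False
  have "total_flow q X (Suc M) = q * total_flow q X M"
    using False by (simp add: total_flow_def flow_def mass_def mult_mat_banded sum_distrib_left mult_ac)
  also have "\<dots> \<le> (q + (1 - q) * q) * total_flow q X M"
    using q by (intro mult_right_mono) (auto simp: total_flow_def flow_nonneg sum_nonneg)
  finally show ?thesis .
next
  case True
  let ?\<phi> = "\<lambda>l. q ^ Suc M / q ^ l * newton_weight q l"
  have "total_flow q X (Suc M) = (\<Sum>l\<le>Suc M. of_real (mult_mat q X (Suc M) l 0) * ?\<phi> l)"
    by (simp only: total_flow_def flow_def mass_def of_real_eq_id id_apply mult_ac)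
  also have "\<dots> = (\<Sum>l\<le>M. mult_mat q X M l 0 * ((1 - q ^ M / q ^ l) * ?\<phi> l + q ^ M * ?\<phi> (Suc l)))"
    unfolding mult_mat_column_step[OF True] by simp
  also have "\<dots> = (\<Sum>l\<le>M. flow q X M l * (q + (1 - q) * (q ^ M / q ^ l)))"
    using q by (intro sum.cong refl) (simp add: flow_def mass_def newton_weight_def field_simps)
  also have "\<dots> \<le> (\<Sum>l\<le>M. flow q X M l * (q + (1 - q) * q))"
  proof (rule sum_mono)
    fix l assume "l \<in> {..M}"
    show "flow q X M l * (q + (1 - q) * (q ^ M / q ^ l)) \<le> flow q X M l * (q + (1 - q) * q)"
    proof (cases "l < M")
      case True
      then have "q ^ M \<le> q ^ Suc l" using q by (intro power_decreasing) auto
      then have "q ^ M / q ^ l \<le> q" using q by (simp add: field_simps)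
      then show ?thesis using q by (intro mult_left_mono add_left_mono flow_nonneg) auto
    next
      case False
      then show ?thesis using mult_mat_banded_gap[OF y, of l] by (simp add: flow_def mass_def)
    qed
  qed
  finally show ?thesis by (simp only: total_flow_def sum_distrib_right[symmetric] mult.commute)
qed

text \<open>
  The contraction factor is \<open>1 - (1 - q)\<^sup>2 < 1\<close>.
\<close>

lemma summable_total_flow:
  assumes "y \<notin> X"
  shows "summable (total_flow q X)"
proof (rule summable_ratio_test)
  have "0 < (1 - q) * (1 - q)" using q by simp
  then show "q + (1 - q) * q < 1" by (simp add: algebra_simps)
  have "0 \<le> total_flow q X n" for n by (simp add: total_flow_def flow_nonneg sum_nonneg)
  then show "norm (total_flow q X (Suc n)) \<le> (q + (1 - q) * q) * norm (total_flow q X n)" if "Suc y \<le> n" for n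
    using total_flow_contracts[OF assms, of n] that by simp
qed

lemma mass_convergent:
  assumes "y \<notin> X"
  shows "convergent (\<lambda>M. mass q X M l)"
proof -
  have "\<bar>mass q X (Suc M) l - mass q X M l\<bar> \<le> 2 * total_flow q X M" for M
  proof -
    have "\<bar>mass q X (Suc M) l - mass q X M l\<bar> \<le> (\<Sum>l<Suc l. \<bar>mass q X (M + 1) l - mass q X M l\<bar>)"
      by (simp add: sum_nonneg)
    also have "\<dots> \<le> 2 * total_flow q X M" using sum_abs_mass_diff_le[of M 1 "Suc l"] by simp
    finally show ?thesis .
  qed
  then have "summable (\<lambda>M. mass q X (Suc M) l - mass q X M l)"
    by (intro summable_comparison_test'[OF summable_mult[OF summable_total_flow[OF assms], of 2], of 0]) simp
  then have "convergent (\<lambda>n. mass q X n l - mass q X 0 l)"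
    unfolding summable_iff_convergent sum_lessThan_telescope[of "\<lambda>M. mass q X M l"] .
  then show ?thesis
    by (simp only: convergent_diff_const_right_iff)
qed

text \<open>
  The first column converges as the masses do, and the recurrence expresses each further column through
  the previous one.
\<close>

lemma mult_mat_convergent:
  assumes y: "y \<notin> X"
  shows "convergent (\<lambda>M. mult_mat q X M i j)"
proof (induction j arbitrary: i)
  case 0
  have "(\<lambda>M. mult_mat q X M i 0) = (\<lambda>M. mass q X M i * (1 / newton_weight q i))"
    using newton_weight_pos[OF q(1), of i] by (auto simp: mass_def)
  then show ?case by (simp only: convergent_mult[OF mass_convergent[OF y] convergent_const])
next
  case (Suc j)
  have "q \<noteq> 0" using q by simp
  show ?case
    unfolding mult_mat_recurrence[OF \<open>q \<noteq> 0\<close>]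
    by (cases i) (auto intro!: convergent_add convergent_mult convergent_const Suc)
qed

lemma sum_abs_mass_limit_le:
  assumes y: "y \<notin> X"
  shows "(\<Sum>l<L. \<bar>lim (\<lambda>M. mass q X M l) - mass q X M l\<bar>) \<le> 2 * (\<Sum>m. total_flow q X (m + M))"
proof (rule LIMSEQ_le_const2)
  show "(\<lambda>k. \<Sum>l<L. \<bar>mass q X (k + M) l - mass q X M l\<bar>) \<longlonglongrightarrow>
      (\<Sum>l<L. \<bar>lim (\<lambda>M. mass q X M l) - mass q X M l\<bar>)"
    by (intro tendsto_sum tendsto_rabs tendsto_diff tendsto_const
        LIMSEQ_ignore_initial_segment[of "\<lambda>k. mass q X k l" for l]
        convergent_LIMSEQ_iff[THEN iffD1] mass_convergent[OF y])
  have "(\<Sum>l<L. \<bar>mass q X (k + M) l - mass q X M l\<bar>) \<le> 2 * (\<Sum>m. total_flow q X (m + M))" for k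
  proof -
    have "(\<Sum>m<k. total_flow q X (m + M)) \<le> (\<Sum>m. total_flow q X (m + M))"
      by (intro sum_le_suminf summable_ignore_initial_segment summable_total_flow[OF y])
        (auto simp: total_flow_def flow_nonneg sum_nonneg)
    then show ?thesis
      using sum_abs_mass_diff_le[of M k L] by (simp add: add.commute sum_distrib_left[symmetric])
  qed
  then show "\<exists>N. \<forall>k\<ge>N. (\<Sum>l<L. \<bar>mass q X (k + M) l - mass q X M l\<bar>) \<le> 2 * (\<Sum>m. total_flow q X (m + M))"
    by blast
qed

lemma partial_product_tendsto:
  "(\<lambda>M. \<Prod>x<M. if x \<in> X then 1 - of_real (q ^ x) * t else 1) \<longlonglongrightarrow>
    (\<Prod>x. if x \<in> X then 1 - of_real (q ^ x) * (t::complex) else 1)"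
proof -
  have "summable (\<lambda>x. norm t * q ^ x)" using q by (intro summable_mult summable_geometric) auto
  then have "summable (\<lambda>x. norm ((if x \<in> X then 1 - of_real (q ^ x) * t else 1) - 1))"
    by (rule summable_comparison_test'[of _ 0]) (use q in \<open>auto simp: norm_mult norm_power\<close>)
  then have "convergent_prod (\<lambda>x. if x \<in> X then 1 - of_real (q ^ x) * t else 1)"
    by (intro abs_convergent_prod_imp_convergent_prod summable_imp_abs_convergent_prod)
  from convergent_prod_LIMSEQ[OF this] show ?thesis
    by (subst LIMSEQ_lessThan_iff_atMost)
qed

text \<open>
  Compare the series with the finite expansion of the partial product up to a fixed large \<open>M\<close>: the
  \<open>L\<close>-th partial sums differ by at most a constant times the \<open>\<ell>\<^sup>1\<close> distance of the masses, uniformly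
  in \<open>L > M\<close>.
\<close>

lemma newton_series_sums:
  assumes y: "y \<notin> X"
  shows "(\<lambda>l. of_real (lim (\<lambda>M. mult_mat q X M l 0)) * newton_basis q l t) sums
    (\<Prod>x. if x \<in> X then 1 - of_real (q ^ x) * t else 1)"
  unfolding sums_def
proof (rule LIMSEQ_I)
  fix e :: real assume e: "0 < e"
  let ?P = "\<lambda>M. \<Prod>x<M. if x \<in> X then 1 - of_real (q ^ x) * t else 1"
  let ?H = "\<Prod>x. if x \<in> X then 1 - of_real (q ^ x) * t else 1"
  let ?c = "\<lambda>l. lim (\<lambda>M. mult_mat q X M l 0)"
  define K where "K = exp (norm t / (1 - q))"
  have K: "0 < K" by (simp add: K_def)
  obtain M1 where M1: "norm (?P M - ?H) < e / 2" if "M \<ge> M1" for M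
    using LIMSEQ_D[OF partial_product_tendsto, of "e / 2" t] e by auto
  obtain M2 where M2: "norm (\<Sum>m. total_flow q X (m + M)) < e / (4 * K)" if "M \<ge> M2" for M
    using suminf_exist_split[OF _ summable_total_flow[OF y], of "e / (4 * K)"] e K by auto
  define M where "M = max M1 M2"
  have "norm ((\<Sum>l<L. of_real (?c l) * newton_basis q l t) - ?H) < e" if L: "L > M" for L
  proof -
    have P: "?P M = (\<Sum>l<L. of_real (mult_mat q X M l 0) * newton_basis q l t)"
    proof -
      have "q \<noteq> 0" using q by simp
      then show ?thesis unfolding newton_expansion_partial_product[OF \<open>q \<noteq> 0\<close>]
        using L by (intro sum.mono_neutral_left) (auto simp: mult_mat_banded)
    qed
    have lim_mass: "lim (\<lambda>M. mass q X M l) = ?c l * newton_weight q l" for l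
      unfolding mass_def
      by (intro limI tendsto_mult tendsto_const convergent_LIMSEQ_iff[THEN iffD1] mult_mat_convergent[OF y])
    have "norm ((\<Sum>l<L. of_real (?c l) * newton_basis q l t) - ?P M) \<le>
        (\<Sum>l<L. norm (of_real (?c l - mult_mat q X M l 0) * newton_basis q l t))"
      unfolding P sum_subtractf[symmetric] left_diff_distrib[symmetric] of_real_diff[symmetric]
      by (rule norm_sum)
    also have "\<dots> \<le> (\<Sum>l<L. \<bar>lim (\<lambda>M. mass q X M l) - mass q X M l\<bar> * K)"
    proof (rule sum_mono)
      fix l
      have "norm (of_real (?c l - mult_mat q X M l 0) * newton_basis q l t) \<le>
          \<bar>?c l - mult_mat q X M l 0\<bar> * (newton_weight q l * K)"
        unfolding norm_mult norm_of_real K_def by (intro mult_left_mono norm_newton_basis_le q) auto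
      also have "\<dots> = \<bar>lim (\<lambda>M. mass q X M l) - mass q X M l\<bar> * K"
        using newton_weight_pos[OF q(1), of l] unfolding lim_mass unfolding mass_def left_diff_distrib[symmetric] abs_mult
        by simp
      finally show "norm (of_real (?c l - mult_mat q X M l 0) * newton_basis q l t) \<le>
          \<bar>lim (\<lambda>M. mass q X M l) - mass q X M l\<bar> * K" .
    qed
    also have "\<dots> \<le> 2 * (\<Sum>m. total_flow q X (m + M)) * K"
      unfolding sum_distrib_right[symmetric] using K by (intro mult_right_mono sum_abs_mass_limit_le[OF y]) auto
    also have "\<dots> < e / 2"
    proof -
      have "(\<Sum>m. total_flow q X (m + M)) < e / (4 * K)" using M2[of M] by (simp add: M_def)
      then show ?thesis using K by (simp add: field_simps)
    qed
    finally have "norm ((\<Sum>l<L. of_real (?c l) * newton_basis q l t) - ?P M) < e / 2" .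
    moreover have "norm (?P M - ?H) < e / 2" using M1[of M] by (simp add: M_def)
    ultimately show ?thesis by (rule norm_diff_triangle_less[THEN order_less_le_trans]) simp
  qed
  then show "\<exists>L0. \<forall>L\<ge>L0. norm ((\<Sum>l<L. of_real (?c l) * newton_basis q l t) - ?H) < e"
    by (intro exI[of _ "Suc M"]) auto
qed

end

section \<open>The associated matrix and its minors\<close>

definition limit_mat :: "real \<Rightarrow> nat set \<Rightarrow> nat \<Rightarrow> nat \<Rightarrow> real" where
  "limit_mat q X i j = lim (\<lambda>M. mult_mat q X M i j)"

lemma mult_mat_tendsto:
  assumes "0 < q" "q < 1" "y \<notin> X"
  shows "(\<lambda>M. mult_mat q X M i j) \<longlonglongrightarrow> limit_mat q X i j"
  unfolding limit_mat_def using mult_mat_convergent[OF assms] by (simp add: convergent_LIMSEQ_iff)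

lemma row_minor_tendsto:
  assumes "\<And>i j. (\<lambda>M. A M i j) \<longlonglongrightarrow> B i j"
  shows "(\<lambda>M. row_minor (A M) N f) \<longlonglongrightarrow> row_minor B N f"
proof -
  have "row_minor C N f = (\<Sum>p | p permutes {0..<N}. signof p * (\<Prod>i<N. C (f i) (p i)))" for C
  proof -
    have "p i < N" if "p permutes {0..<N}" "i < N" for p i
      using permutes_in_image[OF that(1), of i] that(2) by simp
    then show ?thesis
      by (auto simp: row_minor_def det_def'[of _ N] atLeast0LessThan intro!: sum.cong prod.cong)
  qed
  then show ?thesis by (auto intro!: tendsto_intros assms)
qed

lemma row_minor_limit_mat_nonneg:
  assumes "0 < q" "q < 1" "y \<notin> X" "strict_mono_on {..<N} f"
  shows "0 \<le> row_minor (limit_mat q X) N f"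
proof (rule LIMSEQ_le_const)
  show "(\<lambda>M. row_minor (mult_mat q X M) N f) \<longlonglongrightarrow> row_minor (limit_mat q X) N f"
    by (intro row_minor_tendsto mult_mat_tendsto[OF assms(1-3)])
  show "\<exists>M0. \<forall>M\<ge>M0. 0 \<le> row_minor (mult_mat q X M) N f"
    using row_minor_mult_mat[OF assms(1,2,4)] by blast
qed

lemma q_toeplitz_unique:
  assumes d: "q_toeplitz q d" "q_toeplitz q d'" and col: "\<And>i. 1 \<le> i \<Longrightarrow> d i 1 = d' i 1"
  shows "d = d'"
proof -
  have "d i j = d' i j" for i j
  proof (induction j arbitrary: i)
    case 0
    show ?case using d by (simp add: q_toeplitz_def)
  next
    case (Suc j)
    consider "i = 0" | "i > 0" "j = 0" | "i > 0" "j > 0" by blast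
    then show ?case
    proof cases
      case 1
      then show ?thesis using d by (simp add: q_toeplitz_def)
    next
      case 2
      then show ?thesis using col[of i] by simp
    next
      case 3
      then show ?thesis using d Suc by (simp add: q_toeplitz_def)
    qed
  qed
  then show ?thesis by blast
qed

lemma q_newton_expansion_iff:
  "q_newton_expansion q H c \<longleftrightarrow> (\<forall>t. (\<lambda>l. of_real (c l) * newton_basis q l t) sums H t)"
  by (simp add: q_newton_expansion_def newton_basis_def power_int_minus divide_inverse)

text \<open>
  At the node \<open>q\<^sup>-\<^sup>k\<close> the series stops after the term \<open>k\<close>, whose basis function does not vanish there.
\<close>

lemma q_newton_expansion_unique:
  assumes q: "0 < q" "q < 1" and c: "q_newton_expansion q H c" "q_newton_expansion q H c'"
  shows "c = c'"
proof -
  have "c k = c' k" for k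
  proof (induction k rule: less_induct)
    case (less k)
    define t :: complex where "t = of_real (1 / q ^ k)"
    have vanish: "newton_basis q l t = 0" if "k < l" for l
      unfolding newton_basis_def t_def using that by (intro prod_zero) auto
    have nz: "newton_basis q k t \<noteq> 0"
    proof -
      have "1 / q ^ i \<noteq> 1 / q ^ k" if "i < k" for i
        using power_strict_decreasing[OF that q] by (simp add: inverse_eq_divide[symmetric])
      then show ?thesis
        unfolding newton_basis_def t_def by (simp only: prod_zero_iff finite_lessThan right_minus_eq of_real_eq_iff) blast
    qed
    have eval: "H t = (\<Sum>l\<le>k. of_real (b l) * newton_basis q l t)" if "q_newton_expansion q H b" for b
    proof (rule sums_unique2)
      show "(\<lambda>l. of_real (b l) * newton_basis q l t) sums H t"
        using that by (simp add: q_newton_expansion_iff)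
      show "(\<lambda>l. of_real (b l) * newton_basis q l t) sums (\<Sum>l\<le>k. of_real (b l) * newton_basis q l t)"
        by (intro sums_finite) (auto simp: vanish)
    qed
    have "(\<Sum>l<k. of_real (c l) * newton_basis q l t) = (\<Sum>l<k. of_real (c' l) * newton_basis q l t)"
      using less by (intro sum.cong) auto
    then have "of_real (c k) * newton_basis q k t = of_real (c' k) * newton_basis q k t"
      using eval[OF c(1)] eval[OF c(2)] unfolding lessThan_Suc_atMost[symmetric] sum.lessThan_Suc by (metis add_left_imp_eq)
    then show ?case using nz by simp
  qed
  then show ?thesis by blast
qed

text \<open>
  The recurrence passes to the limit, the first column consists of the Newton coefficients of the
  infinite product, and both determine the matrix. The shift by one translates between indices counted
  from 0 and from 1.
\<close>

lemma associated_q_toeplitz_H_nu: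
  assumes q: "0 < q" "q < 1" and y: "y \<notin> X_nu \<nu>"
  shows "associated_q_toeplitz q (H_nu q \<nu>) =
    (\<lambda>i j. if i = 0 \<or> j = 0 then 0 else limit_mat q (X_nu \<nu>) (i - 1) (j - 1))" (is "_ = ?d")
  unfolding associated_q_toeplitz_def
proof (rule the_equality)
  let ?D = "limit_mat q (X_nu \<nu>)"
  note lim = mult_mat_tendsto[OF q y]
  have q0: "q \<noteq> 0" using q by simp
  have rec: "?D i (Suc j) = (if i = 0 then 0 else ?D (i - 1) j) + (1 / q ^ j - 1 / q ^ i) * ?D i j" for i j
  proof (rule LIMSEQ_unique[OF lim])
    show "(\<lambda>M. mult_mat q (X_nu \<nu>) M i (Suc j)) \<longlonglongrightarrow>
        (if i = 0 then 0 else ?D (i - 1) j) + (1 / q ^ j - 1 / q ^ i) * ?D i j"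
      unfolding mult_mat_recurrence[OF q0]
      by (cases i) (auto intro!: tendsto_intros lim)
  qed
  have toeplitz: "q_toeplitz q ?d"
    unfolding q_toeplitz_def
  proof (intro conjI allI impI)
    fix i j :: nat assume "0 < i" "0 < j"
    then obtain i' j' where [simp]: "i = Suc i'" "j = Suc j'" by (meson gr0_implies_Suc)
    show "?d i (j + 1) = ?d (i - 1) j + (q powi (1 - int j) - q powi (1 - int i)) * ?d i j"
      by (simp add: rec power_int_minus divide_inverse)
  qed auto
  have newton: "q_newton_expansion q (H_nu q \<nu>) (\<lambda>l. ?D l 0)"
    using newton_series_sums[OF q y] by (simp add: q_newton_expansion_iff H_nu_def limit_mat_def)
  show "q_toeplitz q ?d \<and> (\<exists>c. q_newton_expansion q (H_nu q \<nu>) c \<and> (\<forall>i\<ge>1. ?d i 1 = c (i - 1)))"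
    using toeplitz newton by (intro conjI exI[of _ "\<lambda>l. ?D l 0"]) auto
  fix d assume d: "q_toeplitz q d \<and> (\<exists>c. q_newton_expansion q (H_nu q \<nu>) c \<and> (\<forall>i\<ge>1. d i 1 = c (i - 1)))"
  then obtain c where c: "q_newton_expansion q (H_nu q \<nu>) c" "\<And>i. 1 \<le> i \<Longrightarrow> d i 1 = c (i - 1)" by blast
  have "c = (\<lambda>l. ?D l 0)" by (rule q_newton_expansion_unique[OF q c(1) newton])
  then show "d = ?d" using d c(2) by (intro q_toeplitz_unique[OF _ toeplitz]) auto
qed

lemma det_zero_column:
  fixes A :: "nat \<Rightarrow> nat \<Rightarrow> 'a::comm_ring_1"
  assumes "b < N" "\<And>a. a < N \<Longrightarrow> A a b = 0"
  shows "Determinant.det (Matrix.mat N N (\<lambda>(a, b). A a b)) = 0"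
proof -
  have "(\<Prod>i = 0..<N. Matrix.mat N N (\<lambda>(a, b). A a b) $$ (i, p i)) = 0" if "p permutes {0..<N}" for p
  proof -
    have "b \<in> p ` {0..<N}" using permutes_image[OF that] assms(1) by simp
    then obtain a where "a < N" "p a = b" by auto
    then show ?thesis using assms by (intro prod_zero) (auto intro!: bexI[of _ a])
  qed
  then show ?thesis by (subst det_def'[of _ N]) (auto intro!: sum.neutral)
qed

theorem proposition1p4:
  fixes q :: real and \<nu> :: "nat \<Rightarrow> nat"
  assumes "0 < q" and "q < 1"
    and "\<And>j. 1 \<le> j \<Longrightarrow> \<nu> j \<le> \<nu> (j + 1)"
  shows "\<forall>N. \<forall>m \<in> initial_minors N (associated_q_toeplitz q (H_nu q \<nu>)). 0 \<le> m"
proof (intro allI ballI)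
  fix N m assume m: "m \<in> initial_minors N (associated_q_toeplitz q (H_nu q \<nu>))"
  \<comment> \<open>The index \<open>j = 1\<close> excludes \<open>\<nu> 1 + 1 - 1\<close>.\<close>
  have y: "\<nu> 1 \<notin> X_nu \<nu>" unfolding X_nu_def by force
  let ?D = "limit_mat q (X_nu \<nu>)"
  let ?d = "\<lambda>i j. if i = 0 \<or> j = 0 then 0 else ?D (i - 1) (j - 1)"
  have first: "sorted_list_of_set {1..N} ! b = Suc b" if "b < N" for b
    using that sorted_list_of_set_range[of 1 "Suc N"] by (simp add: atLeastLessThanSuc_atLeastAtMost del: upt_Suc)
  have pos: "sorted_list_of_set I ! a > 0" if "I \<subseteq> {1..}" "finite I" "a < card I" for I :: "nat set" and a
  proof -
    have "sorted_list_of_set I ! a \<in> I" using nth_mem[of a "sorted_list_of_set I"] that by simp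
    then show ?thesis using that by auto
  qed
  have columns: "0 \<le> matrix_minor ?d I {1..N}" if I: "I \<subseteq> {1..}" "finite I" "card I = N" for I
  proof -
    let ?f = "\<lambda>a. sorted_list_of_set I ! a - 1"
    have "strict_mono_on {..<N} ?f"
    proof (rule strict_mono_onI)
      fix a b assume ab: "a \<in> {..<N}" "b \<in> {..<N}" "a < b"
      then have "sorted_list_of_set I ! a < sorted_list_of_set I ! b"
        using I by (intro sorted_wrt_nth_less[OF strict_sorted_list_of_set]) auto
      then show "?f a < ?f b" using pos[OF I(1,2), of a] ab I by auto
    qed
    moreover have "matrix_minor ?d I {1..N} = row_minor ?D N ?f"
      unfolding matrix_minor_def row_minor_def card_atLeastAtMost I
      by (intro arg_cong[where f = Determinant.det] eq_matI) (use first pos[OF I(1,2)] I(3) in \<open>force+\<close>)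
    ultimately show ?thesis using row_minor_limit_mat_nonneg[OF assms(1,2) y] by simp
  qed
  have rows: "0 \<le> matrix_minor ?d {1..N} J" if J: "J \<subseteq> {1..}" "finite J" "card J = N" for J
  proof (cases "J = {1..N}")
    case True
    then show ?thesis using columns[OF J] by simp
  next
    case False
    \<comment> \<open>A column of \<open>J\<close> beyond \<open>N\<close> lies above the diagonal in the first \<open>N\<close> rows.\<close>
    have "\<not> J \<subseteq> {1..N}" using card_subset_eq[of "{1..N}" J] J False by auto
    then obtain j where "j \<in> J" "N < j" using J(1) by force
    then obtain b where b: "b < N" "sorted_list_of_set J ! b = j"
      using J by (metis set_sorted_list_of_set in_set_conv_nth length_sorted_list_of_set)
    have zero: "?D i k = 0" if "i < k" for i k
      unfolding limit_mat_def using that by (simp add: mult_mat_lower_triangular)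
    have "Determinant.det (Matrix.mat N N
        (\<lambda>(a, b). ?d (sorted_list_of_set {1..N} ! a) (sorted_list_of_set J ! b))) = 0"
      by (rule det_zero_column[OF b(1)]) (use \<open>N < j\<close> b first in \<open>auto intro!: zero\<close>)
    then show ?thesis using J(3) by (simp add: matrix_minor_def del: One_nat_def)
  qed
  show "0 \<le> m"
    using m columns rows
    unfolding initial_minors_def associated_q_toeplitz_H_nu[OF assms(1,2) y] by blast
qed

end
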